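(* Let $(A,\cdot,\diamond,\varepsilon,\alpha)$ be a Hom-Novikov-Poisson color Hom-algebra, and set $$[x,y]=x\diamond y-\varepsilon(x,y)\,y\diamond x,\qquad\forall x,y\in\mathcal H(A).$$ Then $(A,\cdot,[\cdot,\cdot],\varepsilon,\alpha)$ is a Hom-Gelfand-Dorfman color Hom-algebra.
   Context: $\mathbb K$ is an algebraically closed field of characteristic $0$; all spaces are over $\mathbb K$. $\Gamma$ is an abelian group and $\varepsilon:\Gamma\times\Gamma\to\mathbb K^*=\mathbb K\setminus\{0\}$ is a commutation factor: $\varepsilon(a,b)\varepsilon(b,a)=1$, $\varepsilon(a,b+c)=\varepsilon(a,b)\varepsilon(a,c)$, $\varepsilon(a+b,c)=\varepsilon(a,c)\varepsilon(b,c)$. For a $\Gamma$-graded linear space $V$, $\mathcal H(V)$ is the set of homogeneous elements; inside $\varepsilon$ a homogeneous element stands for its degree (so $\varepsilon(x+y,z)=\varepsilon(\deg x+\deg y,\deg z)$). A linear map is even if it preserves degrees; a bilinear multiplication on $A$ is even if $A_\gamma A_{\gamma'}\subseteq A_{\gamma+\gamma'}$. A color Hom-algebra $(A,\cdot,\varepsilon,\alpha)$ is a $\Gamma$-graded space $A$ with an even bilinear multiplication $\cdot$ and an even linear map $\alpha:A\to A$ (not assumed multiplicative). All identities are for all homogeneous $x,y,z$. $\varepsilon$-commutative Hom-associative color Hom-algebra $(A,\cdot,\varepsilon,\alpha)$: a color Hom-algebra with $\alpha(x)\cdot(y\cdot z)=(x\cdot y)\cdot\alpha(z)$ and $x\cdot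 y=\varepsilon(x,y)y\cdot x$. Hom-Novikov color Hom-algebra $(A,\diamond,\varepsilon,\alpha)$: a color Hom-algebra with $(x\diamond y)\diamond\alpha(z)-\alpha(x)\diamond(y\diamond z)=\varepsilon(x,y)\big((y\diamond x)\diamond\alpha(z)-\alpha(y)\diamond(x\diamond z)\big)$ and $(x\diamond y)\diamond\alpha(z)=\varepsilon(y,z)(x\diamond z)\diamond\alpha(y)$. Hom-Novikov-Poisson color Hom-algebra $(A,\cdot,\diamond,\varepsilon,\alpha)$: $(A,\cdot,\varepsilon,\alpha)$ is $\varepsilon$-commutative Hom-associative, $(A,\diamond,\varepsilon,\alpha)$ is Hom-Novikov, and $(x\cdot y)\diamond\alpha(z)=\varepsilon(y,z)(x\diamond z)\cdot\alpha(y)$, $(x\diamond y)\cdot\alpha(z)-\alpha(x)\diamond(y\cdot z)=\varepsilon(x,y)\big((y\diamond x)\cdot\alpha(z)-\alpha(y)\diamond(x\cdot z)\big)$. Hom-Lie color Hom-algebra $(A,[\cdot,\cdot],\varepsilon,\alpha)$: $[\cdot,\cdot]$ even bilinear, $\alpha$ even linear, $[x,y]=-\varepsilon(x,y)[y,x]$ and $\circlearrowleft_{x,y,z}\varepsilon(z,x)[\alpha(x),[y,z]]=0$ (cyclic sum over $(x,y,z)$). Hom-Gelfand-Dorfman color Hom-algebra $(A,\cdot,[\cdot,\cdot],\varepsilon,\alpha)$: $(A,\cdot,\varepsilon,\alpha)$ is a Hom-Novikov color Hom-algebra, $(A,[\cdot,\cdot],\varepsilon,\alpha)$ is a Hom-Lie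 color Hom-algebra, and $\alpha(y)\cdot[x,z]=\varepsilon(y,x)[\alpha(x),y\cdot z]-\varepsilon(x+y,z)[\alpha(z),y\cdot x]+[y,x]\cdot\alpha(z)-\varepsilon(x,z)[y,z]\cdot\alpha(x)$. *)

theory Defs
  imports "HOL-Computational_Algebra.Computational_Algebra"
begin

locale commutation_factor =
  fixes eps :: "'g::ab_group_add \<Rightarrow> 'g \<Rightarrow> 'k::field"
  assumes eps_nonzero: "eps a b \<noteq> 0"
    and eps_inverse: "eps a b * eps b a = 1"
    and eps_add_right: "eps a (b + c) = eps a b * eps a c"
    and eps_add_left: "eps (a + b) c = eps a c * eps b c"

text \<open>The underlying space is the whole type \<open>'v\<close>; \<open>V a\<close> is its component of degree \<open>a\<close>.\<close>

locale graded_space = vector_space scale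
  for scale :: "'k::{alg_closed_field, field_char_0} \<Rightarrow> 'v::ab_group_add \<Rightarrow> 'v" +
  fixes V :: "'g::ab_group_add \<Rightarrow> 'v set"
  assumes subspace_component: "subspace (V a)"
    and unique_decomposition:
      "\<exists>!c. (\<forall>a. c a \<in> V a) \<and> finite {a. c a \<noteq> 0} \<and> x = (\<Sum>a | c a \<noteq> 0. c a)"

definition component :: "('g \<Rightarrow> 'v::ab_group_add set) \<Rightarrow> 'v \<Rightarrow> 'g \<Rightarrow> 'v" where
  "component V x =
    (THE c. (\<forall>a. c a \<in> V a) \<and> finite {a. c a \<noteq> 0} \<and> x = (\<Sum>a | c a \<noteq> 0. c a))"

definition even_linear ::
    "('k::field \<Rightarrow> 'v::ab_group_add \<Rightarrow> 'v) \<Rightarrow> ('g \<Rightarrow> 'v set) \<Rightarrow> ('v \<Rightarrow> 'v) \<Rightarrow> bool" where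
  "even_linear scale V f \<longleftrightarrow>
    Vector_Spaces.linear scale scale f \<and> (\<forall>a. \<forall>x\<in>V a. f x \<in> V a)"

definition even_bilinear ::
    "('k::field \<Rightarrow> 'v::ab_group_add \<Rightarrow> 'v) \<Rightarrow> ('g::ab_group_add \<Rightarrow> 'v set) \<Rightarrow>
      ('v \<Rightarrow> 'v \<Rightarrow> 'v) \<Rightarrow> bool" where
  "even_bilinear scale V m \<longleftrightarrow>
    (\<forall>x. Vector_Spaces.linear scale scale (\<lambda>y. m x y)) \<and>
    (\<forall>y. Vector_Spaces.linear scale scale (\<lambda>x. m x y)) \<and>
    (\<forall>a b. \<forall>x\<in>V a. \<forall>y\<in>V b. m x y \<in> V (a + b))"

text \<open>
  In all identities below the degrees \<open>a\<close>, \<open>b\<close>, \<open>c\<close> of the homogeneous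
  elements \<open>x\<close>, \<open>y\<close>, \<open>z\<close> are explicit; \<open>0\<close> is homogeneous of every degree.
\<close>

locale color_hom_algebra = graded_space scale V + commutation_factor eps
  for scale :: "'k::{alg_closed_field, field_char_0} \<Rightarrow> 'v::ab_group_add \<Rightarrow> 'v"
    and V :: "'g::ab_group_add \<Rightarrow> 'v set"
    and eps :: "'g \<Rightarrow> 'g \<Rightarrow> 'k" +
  fixes m :: "'v \<Rightarrow> 'v \<Rightarrow> 'v"
    and \<alpha> :: "'v \<Rightarrow> 'v"
  assumes even_mult: "even_bilinear scale V m"
    and even_twist: "even_linear scale V \<alpha>"

locale comm_hom_assoc_color = color_hom_algebra scale V eps m \<alpha>
  for scale :: "'k::{alg_closed_field, field_char_0} \<Rightarrow> 'v::ab_group_add \<Rightarrow> 'v"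
    and V :: "'g::ab_group_add \<Rightarrow> 'v set"
    and eps :: "'g \<Rightarrow> 'g \<Rightarrow> 'k"
    and m :: "'v \<Rightarrow> 'v \<Rightarrow> 'v" (infixl "\<cdot>" 70)
    and \<alpha> :: "'v \<Rightarrow> 'v" +
  assumes hom_assoc: "\<lbrakk>x \<in> V a; y \<in> V b; z \<in> V c\<rbrakk> \<Longrightarrow> \<alpha> x \<cdot> (y \<cdot> z) = (x \<cdot> y) \<cdot> \<alpha> z"
    and eps_commute: "\<lbrakk>x \<in> V a; y \<in> V b\<rbrakk> \<Longrightarrow> x \<cdot> y = scale (eps a b) (y \<cdot> x)"

locale hom_novikov_color = color_hom_algebra scale V eps m \<alpha>
  for scale :: "'k::{alg_closed_field, field_char_0} \<Rightarrow> 'v::ab_group_add \<Rightarrow> 'v"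
    and V :: "'g::ab_group_add \<Rightarrow> 'v set"
    and eps :: "'g \<Rightarrow> 'g \<Rightarrow> 'k"
    and m :: "'v \<Rightarrow> 'v \<Rightarrow> 'v" (infixl "\<diamondop>" 70)
    and \<alpha> :: "'v \<Rightarrow> 'v" +
  assumes left_symmetric: "\<lbrakk>x \<in> V a; y \<in> V b; z \<in> V c\<rbrakk> \<Longrightarrow>
      (x \<diamondop> y) \<diamondop> \<alpha> z - \<alpha> x \<diamondop> (y \<diamondop> z) =
      scale (eps a b) ((y \<diamondop> x) \<diamondop> \<alpha> z - \<alpha> y \<diamondop> (x \<diamondop> z))"
    and right_commute: "\<lbrakk>x \<in> V a; y \<in> V b; z \<in> V c\<rbrakk> \<Longrightarrow>
      (x \<diamondop> y) \<diamondop> \<alpha> z = scale (eps b c) ((x \<diamondop> z) \<diamondop> \<alpha> y)"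

locale hom_novikov_poisson_color =
  comm_hom_assoc_color scale V eps dot \<alpha> + dia: hom_novikov_color scale V eps dia \<alpha>
  for scale :: "'k::{alg_closed_field, field_char_0} \<Rightarrow> 'v::ab_group_add \<Rightarrow> 'v"
    and V :: "'g::ab_group_add \<Rightarrow> 'v set"
    and eps :: "'g \<Rightarrow> 'g \<Rightarrow> 'k"
    and dot :: "'v \<Rightarrow> 'v \<Rightarrow> 'v" (infixl "\<cdot>" 70)
    and dia :: "'v \<Rightarrow> 'v \<Rightarrow> 'v" (infixl "\<diamondop>" 70)
    and \<alpha> :: "'v \<Rightarrow> 'v" +
  assumes dot_dia: "\<lbrakk>x \<in> V a; y \<in> V b; z \<in> V c\<rbrakk> \<Longrightarrow>
      (x \<cdot> y) \<diamondop> \<alpha> z = scale (eps b c) ((x \<diamondop> z) \<cdot> \<alpha> y)"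
    and dia_dot: "\<lbrakk>x \<in> V a; y \<in> V b; z \<in> V c\<rbrakk> \<Longrightarrow>
      (x \<diamondop> y) \<cdot> \<alpha> z - \<alpha> x \<diamondop> (y \<cdot> z) =
      scale (eps a b) ((y \<diamondop> x) \<cdot> \<alpha> z - \<alpha> y \<diamondop> (x \<cdot> z))"

locale hom_lie_color = color_hom_algebra scale V eps br \<alpha>
  for scale :: "'k::{alg_closed_field, field_char_0} \<Rightarrow> 'v::ab_group_add \<Rightarrow> 'v"
    and V :: "'g::ab_group_add \<Rightarrow> 'v set"
    and eps :: "'g \<Rightarrow> 'g \<Rightarrow> 'k"
    and br :: "'v \<Rightarrow> 'v \<Rightarrow> 'v"
    and \<alpha> :: "'v \<Rightarrow> 'v" +
  assumes eps_skew: "\<lbrakk>x \<in> V a; y \<in> V b\<rbrakk> \<Longrightarrow> br x y = - scale (eps a b) (br y x)"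
    and hom_jacobi: "\<lbrakk>x \<in> V a; y \<in> V b; z \<in> V c\<rbrakk> \<Longrightarrow>
      scale (eps c a) (br (\<alpha> x) (br y z)) +
      scale (eps a b) (br (\<alpha> y) (br z x)) +
      scale (eps b c) (br (\<alpha> z) (br x y)) = 0"

locale hom_gelfand_dorfman_color =
  hom_novikov_color scale V eps dot \<alpha> + lie: hom_lie_color scale V eps br \<alpha>
  for scale :: "'k::{alg_closed_field, field_char_0} \<Rightarrow> 'v::ab_group_add \<Rightarrow> 'v"
    and V :: "'g::ab_group_add \<Rightarrow> 'v set"
    and eps :: "'g \<Rightarrow> 'g \<Rightarrow> 'k"
    and dot :: "'v \<Rightarrow> 'v \<Rightarrow> 'v" (infixl "\<cdot>" 70)
    and br :: "'v \<Rightarrow> 'v \<Rightarrow> 'v"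
    and \<alpha> :: "'v \<Rightarrow> 'v" +
  assumes compatible: "\<lbrakk>x \<in> V a; y \<in> V b; z \<in> V c\<rbrakk> \<Longrightarrow>
      \<alpha> y \<cdot> br x z =
        scale (eps b a) (br (\<alpha> x) (y \<cdot> z)) - scale (eps (a + b) c) (br (\<alpha> z) (y \<cdot> x))
        + br y x \<cdot> \<alpha> z - scale (eps a c) (br y z \<cdot> \<alpha> x)"

text \<open>
  The bracket \<open>m x y - eps(x,y) m y x\<close> is prescribed on homogeneous elements and extended
  bilinearly to the whole space by means of the homogeneous components; see
  \<open>color_commutator_homogeneous\<close> below.
\<close>

definition color_commutator ::
    "('k::field \<Rightarrow> 'v::ab_group_add \<Rightarrow> 'v) \<Rightarrow> ('g \<Rightarrow> 'v set) \<Rightarrow> ('g \<Rightarrow> 'g \<Rightarrow> 'k) \<Rightarrow>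
      ('v \<Rightarrow> 'v \<Rightarrow> 'v) \<Rightarrow> 'v \<Rightarrow> 'v \<Rightarrow> 'v" where
  "color_commutator scale V eps m x y =
    (\<Sum>a | component V x a \<noteq> 0. \<Sum>b | component V y b \<noteq> 0.
      m (component V x a) (component V y b)
      - scale (eps a b) (m (component V y b) (component V x a)))"

lemma (in graded_space) component_homogeneous:
  assumes "x \<in> V a"
  shows "component V x = (\<lambda>b. if b = a then x else 0)"
proof -
  let ?P = "\<lambda>c. (\<forall>a. c a \<in> V a) \<and> finite {a. c a \<noteq> 0} \<and> x = (\<Sum>a | c a \<noteq> 0. c a)"
  have *: "{b. (if b = a then x else 0) \<noteq> 0} = (if x = 0 then {} else {a})" by auto
  have "?P (\<lambda>b. if b = a then x else 0)"
    unfolding * using assms subspace_0[OF subspace_component] by auto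
  then show ?thesis
    unfolding component_def by (rule the1_equality[OF unique_decomposition[of x]])
qed

lemma (in color_hom_algebra) color_commutator_homogeneous:
  assumes "x \<in> V a" "y \<in> V b"
  shows "color_commutator scale V eps m x y = m x y - scale (eps a b) (m y x)"
proof -
  have z: "m 0 v = 0" "m v 0 = 0" for v
    using even_mult unfolding even_bilinear_def linear_iff_module_hom
    by (auto dest: module_hom.zero)
  have s: "{c. (if c = d then u else 0) \<noteq> 0} = (if u = 0 then {} else {d})" for d :: 'g and u :: 'v
    by auto
  show ?thesis
    unfolding color_commutator_def component_homogeneous[OF assms(1)]
      component_homogeneous[OF assms(2)] s
    by (auto simp: z)
qed

end

theory Submission
  imports Defs
begin

text \<open>
  By Hom-associativity and \<open>\<epsilon>\<close>-commutativity, \<open>\<cdot>\<close> is itself Hom-Novikov. The Jacobi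
  sum of the commutator of \<open>\<diamondop>\<close> is a combination of three instances of left symmetry. In the
  compatibility identity, rewriting \<open>(y \<cdot> z) \<diamondop> \<alpha> x\<close> as a multiple of \<open>(y \<diamondop> x) \<cdot> \<alpha> z\<close>
  cancels two of the four products \<open>(\<dots> \<diamondop> \<dots>) \<cdot> \<alpha> (\<dots>)\<close> on the right; the other two cancel since
  both are multiples of \<open>(x \<cdot> z) \<diamondop> \<alpha> y\<close>; what remains is \<open>dia_dot\<close> for \<open>x, z, y\<close>.
\<close>

section \<open>Linearity of the homogeneous components\<close>

context graded_space
begin

lemma component_eqI:
  assumes "\<And>a. c a \<in> V a" "finite {a. c a \<noteq> 0}" "x = (\<Sum>a | c a \<noteq> 0. c a)"
  shows "component V x = c"
  unfolding component_def by (rule the1_equality[OF unique_decomposition[of x]]) (use assms in blast)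

lemma component_props:
  shows component_in: "component V x a \<in> V a"
    and finite_component: "finite {a. component V x a \<noteq> 0}"
    and component_sum: "(\<Sum>a | component V x a \<noteq> 0. component V x a) = x"
  using theI'[OF unique_decomposition[of x]] unfolding component_def[symmetric] by auto

text \<open>The pointwise sum is a homogeneous decomposition of \<open>x + y\<close>, so uniqueness
  applies. Components may cancel, so its support can be smaller than the union of supports, over
  which all sums are compared.\<close>

lemma component_add: "component V (x + y) a = component V x a + component V y a"
proof -
  let ?S = "{a. component V x a \<noteq> 0} \<union> {a. component V y a \<noteq> 0}"
  let ?c = "\<lambda>a. component V x a + component V y a"
  have S: "finite ?S" by (simp add: finite_component)
  have "(\<Sum>a | ?c a \<noteq> 0. ?c a) = (\<Sum>a\<in>?S. ?c a)"
    by (rule sum.mono_neutral_left[OF S]) auto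
  also have "\<dots> = (\<Sum>a\<in>?S. component V x a) + (\<Sum>a\<in>?S. component V y a)"
    by (rule sum.distrib)
  also have "(\<Sum>a\<in>?S. component V x a) = (\<Sum>a | component V x a \<noteq> 0. component V x a)"
    by (rule sum.mono_neutral_right[OF S]) auto
  also have "(\<Sum>a\<in>?S. component V y a) = (\<Sum>a | component V y a \<noteq> 0. component V y a)"
    by (rule sum.mono_neutral_right[OF S]) auto
  finally have sum: "(\<Sum>a | ?c a \<noteq> 0. ?c a) = x + y" by (simp add: component_sum)
  have "finite {a. ?c a \<noteq> 0}" by (rule finite_subset[OF _ S]) auto
  with sum have "component V (x + y) = ?c"
    by (intro component_eqI subspace_add subspace_component component_in) auto
  then show ?thesis by simp
qed

lemma component_scale: "component V (scale k x) a = scale k (component V x a)"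
proof -
  let ?c = "\<lambda>a. scale k (component V x a)"
  have "(\<Sum>a | ?c a \<noteq> 0. ?c a) = (\<Sum>a | component V x a \<noteq> 0. ?c a)"
    \<comment> \<open>Only an inclusion of supports is used, which also covers
      \<open>k = 0\<close>.\<close>
    by (rule sum.mono_neutral_left[OF finite_component]) auto
  also have "\<dots> = scale k x" by (simp add: scale_sum_right[symmetric] component_sum)
  finally have sum: "(\<Sum>a | ?c a \<noteq> 0. ?c a) = scale k x" .
  have "finite {a. ?c a \<noteq> 0}" by (rule finite_subset[OF _ finite_component]) auto
  with sum have "component V (scale k x) = ?c"
    by (intro component_eqI subspace_scale subspace_component component_in) auto
  then show ?thesis by simp
qed

end

text \<open>The second form removes an inverse pair inside a product bracketed to the right, which
  \<open>mult.assoc\<close> produces.\<close>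

lemma (in commutation_factor) eps_cancel [simp]:
  "eps a b * eps b a = 1" "eps a b * (eps b a * k) = k"
  using eps_inverse[of a b] by (simp_all add: mult.assoc[symmetric])

section \<open>The color commutator as an even bilinear product\<close>

context color_hom_algebra
begin

lemma mult_add_left: "m (x + y) z = m x z + m y z"
  and mult_add_right: "m x (y + z) = m x y + m x z"
  and mult_diff_left: "m (x - y) z = m x z - m y z"
  and mult_diff_right: "m x (y - z) = m x y - m x z"
  and mult_scale_left: "m (scale k x) y = scale k (m x y)"
  and mult_scale_right: "m x (scale k y) = scale k (m x y)"
  and mult_zero_left: "m 0 x = 0"
  and mult_zero_right: "m x 0 = 0"
  using even_mult unfolding even_bilinear_def linear_iff_module_hom
  by (auto dest: module_hom.add module_hom.diff module_hom.scale module_hom.zero)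

lemma mult_in: "x \<in> V a \<Longrightarrow> y \<in> V b \<Longrightarrow> m x y \<in> V (a + b)"
  using even_mult unfolding even_bilinear_def by blast

lemma twist_in: "x \<in> V a \<Longrightarrow> \<alpha> x \<in> V a"
  using even_twist unfolding even_linear_def by blast

text \<open>Added indices contribute nothing because products with 0 vanish. This gives brackets of
  different vectors a common index set, so that they can be compared termwise.\<close>

lemma color_commutator_on_superset:
  assumes "finite S" "finite T" "{a. component V x a \<noteq> 0} \<subseteq> S" "{a. component V y a \<noteq> 0} \<subseteq> T"
  shows "color_commutator scale V eps m x y =
    (\<Sum>a\<in>S. \<Sum>b\<in>T. m (component V x a) (component V y b)
      - scale (eps a b) (m (component V y b) (component V x a)))"
proof -
  let ?f = "\<lambda>a b. m (component V x a) (component V y b)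
      - scale (eps a b) (m (component V y b) (component V x a))"
  have "(\<Sum>b | component V y b \<noteq> 0. ?f a b) = (\<Sum>b\<in>T. ?f a b)" for a
    using assms by (intro sum.mono_neutral_left) (auto simp: mult_zero_left mult_zero_right)
  moreover have "(\<Sum>a | component V x a \<noteq> 0. \<Sum>b\<in>T. ?f a b) = (\<Sum>a\<in>S. \<Sum>b\<in>T. ?f a b)"
    using assms by (intro sum.mono_neutral_left) (auto simp: mult_zero_left mult_zero_right)
  ultimately show ?thesis unfolding color_commutator_def by simp
qed

lemma color_commutator_add_left:
  "color_commutator scale V eps m (x + y) z =
    color_commutator scale V eps m x z + color_commutator scale V eps m y z"
proof -
  let ?S = "{a. component V x a \<noteq> 0} \<union> {a. component V y a \<noteq> 0}"
  let ?T = "{a. component V z a \<noteq> 0}"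
  have "finite ?S" "finite ?T" "{a. component V (x + y) a \<noteq> 0} \<subseteq> ?S"
    by (auto simp: finite_component component_add)
  then show ?thesis
    by (simp add: color_commutator_on_superset[of ?S ?T] component_add mult_add_left mult_add_right
        scale_right_distrib sum.distrib[symmetric] algebra_simps)
qed

lemma color_commutator_add_right:
  "color_commutator scale V eps m z (x + y) =
    color_commutator scale V eps m z x + color_commutator scale V eps m z y"
proof -
  let ?S = "{a. component V x a \<noteq> 0} \<union> {a. component V y a \<noteq> 0}"
  let ?T = "{a. component V z a \<noteq> 0}"
  have "finite ?S" "finite ?T" "{a. component V (x + y) a \<noteq> 0} \<subseteq> ?S"
    by (auto simp: finite_component component_add)
  then show ?thesis
    by (simp add: color_commutator_on_superset[of ?T ?S] component_add mult_add_left mult_add_right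
        scale_right_distrib sum.distrib[symmetric] algebra_simps)
qed

lemma color_commutator_scale_left:
  "color_commutator scale V eps m (scale k x) y = scale k (color_commutator scale V eps m x y)"
proof -
  let ?S = "{a. component V x a \<noteq> 0}" and ?T = "{a. component V y a \<noteq> 0}"
  have "finite ?S" "finite ?T" "{a. component V (scale k x) a \<noteq> 0} \<subseteq> ?S"
    by (auto simp: finite_component component_scale)
  then show ?thesis
    by (simp add: color_commutator_on_superset[of ?S ?T] component_scale mult_scale_left
        mult_scale_right scale_right_diff_distrib scale_sum_right mult.commute)
qed

lemma color_commutator_scale_right:
  "color_commutator scale V eps m x (scale k y) = scale k (color_commutator scale V eps m x y)"
proof -
  let ?S = "{a. component V x a \<noteq> 0}" and ?T = "{a. component V y a \<noteq> 0}"
  have "finite ?S" "finite ?T" "{a. component V (scale k y) a \<noteq> 0} \<subseteq> ?T"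
    by (auto simp: finite_component component_scale)
  then show ?thesis
    by (simp add: color_commutator_on_superset[of ?S ?T] component_scale mult_scale_left
        mult_scale_right scale_right_diff_distrib scale_sum_right mult.commute)
qed

lemma color_commutator_in:
  assumes "x \<in> V a" "y \<in> V b"
  shows "color_commutator scale V eps m x y \<in> V (a + b)"
  unfolding color_commutator_homogeneous[OF assms]
  using mult_in[OF assms] mult_in[OF assms(2,1)]
  by (auto intro!: subspace_diff subspace_scale subspace_component simp: add.commute)

text \<open>Bilinearity is the one property of the bracket required on arbitrary vectors; evenness
  and the identities concern homogeneous ones.\<close>

lemma even_bilinear_color_commutator:
  "even_bilinear scale V (color_commutator scale V eps m)"
  unfolding even_bilinear_def
  by (auto simp: linear_iff_module_hom module_hom_iff module_axioms color_commutator_in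
      color_commutator_add_left color_commutator_add_right
      color_commutator_scale_left color_commutator_scale_right)

text \<open>The outer commutator contributes \<open>eps a (b + c)\<close>, and
  \<open>eps c a * eps a b * eps a c\<close> collapses to \<open>eps a b\<close>. Hence all three
  Jacobi terms have coefficients built from \<open>eps a b\<close>, \<open>eps b c\<close> and
  \<open>eps c a\<close> alone.\<close>

lemma twisted_double_commutator:
  assumes "x \<in> V a" "y \<in> V b" "z \<in> V c"
  shows "scale (eps c a)
      (color_commutator scale V eps m (\<alpha> x) (color_commutator scale V eps m y z)) =
    scale (eps c a) (m (\<alpha> x) (m y z)) - scale (eps c a * eps b c) (m (\<alpha> x) (m z y))
    - scale (eps a b) (m (m y z) (\<alpha> x)) + scale (eps a b * eps b c) (m (m z y) (\<alpha> x))"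
  unfolding color_commutator_homogeneous[OF twist_in[OF assms(1)] color_commutator_in[OF assms(2,3)]]
  by (simp add: color_commutator_homogeneous[OF assms(2,3)] eps_add_right mult_diff_left
      mult_diff_right mult_scale_left mult_scale_right scale_right_diff_distrib
      mult.assoc mult.left_commute[of _ "eps a b"])

end

section \<open>The Hom-Lie bracket and the Hom-Novikov product\<close>

lemma (in hom_novikov_color) hom_lie_color_commutator:
  "hom_lie_color scale V eps (color_commutator scale V eps m) \<alpha>"
proof unfold_locales
  let ?br = "color_commutator scale V eps m"
  show "even_bilinear scale V ?br" by (rule even_bilinear_color_commutator)
  show "?br x y = - scale (eps a b) (?br y x)" if "x \<in> V a" "y \<in> V b" for x y a b
    using that by (simp add: color_commutator_homogeneous scale_right_diff_distrib)
  show "scale (eps c a) (?br (\<alpha> x) (?br y z)) + scale (eps a b) (?br (\<alpha> y) (?br z x))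
      + scale (eps b c) (?br (\<alpha> z) (?br x y)) = 0"
    if "x \<in> V a" "y \<in> V b" "z \<in> V c" for x y z a b c
  proof -
    \<comment> \<open>\<open>?T\<close> is the defect of left symmetry. Its three cyclic instances
      contain four products each, and together each of the twelve products of the Jacobi sum exactly
      once.\<close>
    let ?T = "\<lambda>x y z a b. m (m x y) (\<alpha> z) - m (\<alpha> x) (m y z)
      - scale (eps a b) (m (m y x) (\<alpha> z) - m (\<alpha> y) (m x z))"
    have "scale (eps c a) (?br (\<alpha> x) (?br y z)) + scale (eps a b) (?br (\<alpha> y) (?br z x))
        + scale (eps b c) (?br (\<alpha> z) (?br x y)) =
      - scale (eps c a) (?T x y z a b) - scale (eps a b) (?T y z x b c)
        - scale (eps b c) (?T z x y c a)"
      unfolding twisted_double_commutator[OF that]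
        twisted_double_commutator[OF that(2,3,1)] twisted_double_commutator[OF that(3,1,2)]
      by (simp add: scale_right_diff_distrib algebra_simps)
    also have "\<dots> = 0"
      using left_symmetric[OF that] left_symmetric[OF that(2,3,1)] left_symmetric[OF that(3,1,2)]
      by simp
    finally show ?thesis .
  qed
qed (rule even_twist)

lemma (in comm_hom_assoc_color) hom_novikov_color_dot:
  "hom_novikov_color scale V eps (\<cdot>) \<alpha>"
proof unfold_locales
  fix x y z a b c
  assume xyz: "x \<in> V a" "y \<in> V b" "z \<in> V c"
  show "x \<cdot> y \<cdot> \<alpha> z - \<alpha> x \<cdot> (y \<cdot> z) = scale (eps a b) (y \<cdot> x \<cdot> \<alpha> z - \<alpha> y \<cdot> (x \<cdot> z))"
    \<comment> \<open>Both sides are 0, since every associator vanishes.\<close>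
    using xyz by (simp add: hom_assoc)
  show "x \<cdot> y \<cdot> \<alpha> z = scale (eps b c) (x \<cdot> z \<cdot> \<alpha> y)"
    \<comment> \<open>Rebracketing to \<open>\<alpha> x \<cdot> (y \<cdot> z)\<close> makes
      \<open>y\<close> and \<open>z\<close> adjacent, so they can be exchanged.\<close>
    using hom_assoc[OF xyz] hom_assoc[OF xyz(1,3,2)] eps_commute[OF xyz(2,3)]
    by (simp add: mult_scale_right)
qed

section \<open>The compatibility identity\<close>

context hom_novikov_poisson_color
begin

text \<open>The coefficients are those with which these two products appear, with opposite signs,
  when \<open>[y,x] \<cdot> \<alpha> z\<close> and \<open>[y,z] \<cdot> \<alpha> x\<close> are
  expanded in the compatibility identity.\<close>

lemma dia_dot_swap:
  assumes "x \<in> V a" "y \<in> V b" "z \<in> V c"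
  shows "scale (eps b a) ((x \<diamondop> y) \<cdot> \<alpha> z) = scale (eps a c * eps b c) ((z \<diamondop> y) \<cdot> \<alpha> x)"
proof -
  have "scale (eps c b) ((x \<diamondop> y) \<cdot> \<alpha> z) = (x \<cdot> z) \<diamondop> \<alpha> y"
    using dot_dia[OF assms(1,3,2)] by simp
  also have "\<dots> = scale (eps a c) ((z \<cdot> x) \<diamondop> \<alpha> y)"
    using eps_commute[OF assms(1,3)] by (simp add: dia.mult_scale_left)
  also have "\<dots> = scale (eps a c * eps a b) ((z \<diamondop> y) \<cdot> \<alpha> x)"
    using dot_dia[OF assms(3,1,2)] by simp
  \<comment> \<open>The factor \<open>eps b c\<close> clears \<open>eps c b\<close> on the left, and
    \<open>eps b a\<close> clears \<open>eps a b\<close> on the right.\<close>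
  finally have "scale (eps b a * eps b c) (scale (eps c b) ((x \<diamondop> y) \<cdot> \<alpha> z)) =
      scale (eps b a * eps b c) (scale (eps a c * eps a b) ((z \<diamondop> y) \<cdot> \<alpha> x))"
    by (rule arg_cong)
  moreover have "eps b a * eps b c * eps c b = eps b a"
    "eps b a * eps b c * (eps a c * eps a b) = eps a c * eps b c"
    using eps_inverse[of b c] eps_inverse[of a b] by algebra+
  ultimately show ?thesis by simp
qed

text \<open>The reversed product has coefficient \<open>eps b a * eps a (b + c) = eps a c\<close>,
  which cancels the \<open>eps c a\<close> coming from \<open>dot_dia\<close>.\<close>

lemma twisted_commutator_dot:
  assumes "x \<in> V a" "y \<in> V b" "z \<in> V c"
  shows "scale (eps b a) (color_commutator scale V eps dia (\<alpha> x) (y \<cdot> z)) =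
    scale (eps b a) (\<alpha> x \<diamondop> (y \<cdot> z)) - (y \<diamondop> x) \<cdot> \<alpha> z"
  using dia.color_commutator_homogeneous[OF twist_in[OF assms(1)] mult_in[OF assms(2,3)]]
    dot_dia[OF assms(2,3,1)]
  by (simp add: eps_add_right scale_right_diff_distrib mult.assoc)

lemma commutator_compatible:
  fixes br defines "br \<equiv> color_commutator scale V eps dia"
  assumes "x \<in> V a" "y \<in> V b" "z \<in> V c"
  shows "\<alpha> y \<cdot> br x z =
        scale (eps b a) (br (\<alpha> x) (y \<cdot> z)) - scale (eps (a + b) c) (br (\<alpha> z) (y \<cdot> x))
        + br y x \<cdot> \<alpha> z - scale (eps a c) (br y z \<cdot> \<alpha> x)"
proof -
  note xyz = assms(2-4)
  have yx: "br y x = y \<diamondop> x - scale (eps b a) (x \<diamondop> y)"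
    and yz: "br y z = y \<diamondop> z - scale (eps b c) (z \<diamondop> y)"
    and xz: "br x z = x \<diamondop> z - scale (eps a c) (z \<diamondop> x)"
    unfolding br_def by (simp_all add: dia.color_commutator_homogeneous xyz)
  have 1: "scale (eps b a) (br (\<alpha> x) (y \<cdot> z)) =
      scale (eps b a) (\<alpha> x \<diamondop> (y \<cdot> z)) - (y \<diamondop> x) \<cdot> \<alpha> z"
    unfolding br_def by (rule twisted_commutator_dot[OF xyz])
  \<comment> \<open>The instance for \<open>z\<close>, \<open>y\<close>, \<open>x\<close> carries
    the weight \<open>eps b c\<close>; multiplying it by \<open>eps a c\<close>, padded with
    \<open>eps b c * eps c b = 1\<close>, yields \<open>eps (a + b) c\<close>.\<close>
  have "scale (eps a c * eps b c * eps c b) (scale (eps b c) (br (\<alpha> z) (y \<cdot> x))) =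
      scale (eps a c) (scale (eps b c) (\<alpha> z \<diamondop> (y \<cdot> x)) - (y \<diamondop> z) \<cdot> \<alpha> x)"
    unfolding br_def twisted_commutator_dot[OF xyz(3,2,1)] by (simp add: mult.assoc)
  then have 2: "scale (eps (a + b) c) (br (\<alpha> z) (y \<cdot> x)) =
      scale (eps a c * eps b c) (\<alpha> z \<diamondop> (y \<cdot> x)) - scale (eps a c) ((y \<diamondop> z) \<cdot> \<alpha> x)"
    by (simp add: eps_add_left scale_right_diff_distrib mult.assoc)
  \<comment> \<open>Moving \<open>\<alpha> y\<close> to the right brings the product into the shape
    of \<open>dia_dot\<close>.\<close>
  have "\<alpha> y \<cdot> br x z = scale (eps b a * eps b c) (br x z \<cdot> \<alpha> y)"
    using eps_commute[OF twist_in[OF xyz(2)] dia.color_commutator_in[OF xyz(1,3)]]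
    by (simp add: br_def eps_add_right)
  also have "br x z \<cdot> \<alpha> y = (x \<diamondop> z) \<cdot> \<alpha> y - scale (eps a c) ((z \<diamondop> x) \<cdot> \<alpha> y)"
    by (simp add: xz mult_diff_left mult_scale_left)
  also have "\<dots> = \<alpha> x \<diamondop> (z \<cdot> y) - scale (eps a c) (\<alpha> z \<diamondop> (x \<cdot> y))"
    using dia_dot[OF xyz(1,3,2)] by (simp add: scale_right_diff_distrib algebra_simps)
  \<comment> \<open>Restoring the order \<open>y \<cdot> z\<close> absorbs \<open>eps b c\<close> in
    the first term; restoring \<open>y \<cdot> x\<close> absorbs \<open>eps b a\<close> in the
    second.\<close>
  finally have "\<alpha> y \<cdot> br x z = scale (eps b a) (\<alpha> x \<diamondop> (y \<cdot> z))
      - scale (eps a c * eps b c) (\<alpha> z \<diamondop> (y \<cdot> x))"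
    using eps_commute[OF xyz(2,3)] eps_commute[OF xyz(2,1)]
    by (simp add: dia.mult_scale_right scale_right_diff_distrib ac_simps)
  then show ?thesis
    unfolding 1 2 yx yz using dia_dot_swap[OF xyz]
    by (simp add: mult_diff_left mult_scale_left scale_right_diff_distrib)
qed

end

theorem theorem4p16:
  fixes scale :: "'k::{alg_closed_field, field_char_0} \<Rightarrow> 'v::ab_group_add \<Rightarrow> 'v"
    and V :: "'g::ab_group_add \<Rightarrow> 'v set"
    and eps :: "'g \<Rightarrow> 'g \<Rightarrow> 'k"
    and dot dia :: "'v \<Rightarrow> 'v \<Rightarrow> 'v"
    and \<alpha> :: "'v \<Rightarrow> 'v"
  assumes "hom_novikov_poisson_color scale V eps dot dia \<alpha>"
  shows "hom_gelfand_dorfman_color scale V eps dot (color_commutator scale V eps dia) \<alpha>"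
proof -
  interpret hom_novikov_poisson_color scale V eps dot dia \<alpha> by (rule assms)
  show ?thesis
    by (intro hom_gelfand_dorfman_color.intro hom_gelfand_dorfman_color_axioms.intro
        hom_novikov_color_dot dia.hom_lie_color_commutator commutator_compatible)
qed

end
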